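(* Let $(G,M)$ be a square graph, let $R\subseteq E(G)\setminus M$ contain exactly one edge from each square, and let $\mathcal{H}$ be the set of Hamiltonian cycles of $G$ containing $M$. Then $\mathcal{H}\ne\emptyset$, and $\mathcal{D}:=\{H\cap R: H\in\mathcal{H}\}$ is a delta-matroid on ground set $R$.
   Context: A square graph is a pair $(G,M)$ where $G=(V,E)$ is a cubic $2$-edge-connected graph and $M$ is a perfect matching of $G$ such that the edges of $E\setminus M$ form a node-disjoint union of $4$-cycles, called squares. A family $\mathcal{D}\ne\emptyset$ of subsets of a finite set $S$ is a delta-matroid if for all $D_1,D_2\in\mathcal{D}$ and $j\in D_1\triangle D_2$ there exists $k\in D_1\triangle D_2$ (possibly $k=j$, with $\{j,j\}:=\{j\}$) such that $D_1\triangle\{j,k\}\in\mathcal{D}$. *)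

theory Defs
  imports Main
begin

text \<open>Finite undirected loopless graphs; parallel edges are allowed, so edges are
  abstract and \<open>ends\<close> gives the set of the two end nodes. A simple graph is the
  case where \<open>ends\<close> is injective on the edges. Nothing is lost by excluding loops: in
  a cubic graph the third edge at a node carrying a loop is a bridge.\<close>

record ('v, 'e) mgraph =
  verts :: "'v set"
  edges :: "'e set"
  ends :: "'e \<Rightarrow> 'v set"

definition wf_mgraph :: "('v, 'e) mgraph \<Rightarrow> bool" where
  "wf_mgraph G \<longleftrightarrow> finite (verts G) \<and> finite (edges G) \<and>
     (\<forall>e\<in>edges G. ends G e \<subseteq> verts G \<and> card (ends G e) = 2)"

definition degree :: "('v, 'e) mgraph \<Rightarrow> 'v \<Rightarrow> nat" where
  "degree G v = card {e \<in> edges G. v \<in> ends G e}"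

definition cubic :: "('v, 'e) mgraph \<Rightarrow> bool" where
  "cubic G \<longleftrightarrow> (\<forall>v\<in>verts G. degree G v = 3)"

definition connected_mgraph :: "('v, 'e) mgraph \<Rightarrow> bool" where
  "connected_mgraph G \<longleftrightarrow> verts G \<noteq> {} \<and>
     (\<forall>u\<in>verts G. \<forall>v\<in>verts G. (u, v) \<in> {(x, y). \<exists>e\<in>edges G. ends G e = {x, y}}\<^sup>*)"

definition two_edge_connected :: "('v, 'e) mgraph \<Rightarrow> bool" where
  "two_edge_connected G \<longleftrightarrow> connected_mgraph G \<and>
     (\<forall>e\<in>edges G. connected_mgraph (G\<lparr>edges := edges G - {e}\<rparr>))"

definition perfect_matching :: "('v, 'e) mgraph \<Rightarrow> 'e set \<Rightarrow> bool" where
  "perfect_matching G M \<longleftrightarrow> M \<subseteq> edges G \<and> (\<forall>v\<in>verts G. \<exists>!e. e \<in> M \<and> v \<in> ends G e)"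

text \<open>Cycles are identified with their edge sets. The edge \<open>es ! i\<close> joins \<open>vs ! i\<close> to
  its cyclic successor; a cycle of length 2 consists of two parallel edges.\<close>

definition cycle_with :: "('v, 'e) mgraph \<Rightarrow> 'v list \<Rightarrow> 'e list \<Rightarrow> bool" where
  "cycle_with G vs es \<longleftrightarrow>
     length vs \<ge> 2 \<and> length es = length vs \<and> distinct vs \<and> distinct es \<and>
     set vs \<subseteq> verts G \<and> set es \<subseteq> edges G \<and>
     (\<forall>i<length vs. ends G (es ! i) = {vs ! i, vs ! (Suc i mod length vs)})"

definition hamiltonian_cycle :: "('v, 'e) mgraph \<Rightarrow> 'e set \<Rightarrow> bool" where
  "hamiltonian_cycle G H \<longleftrightarrow>
     (\<exists>vs es. cycle_with G vs es \<and> set vs = verts G \<and> set es = H)"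

definition squares :: "('v, 'e) mgraph \<Rightarrow> 'e set \<Rightarrow> 'e set set" where
  "squares G M = {C. C \<subseteq> edges G - M \<and>
     (\<exists>vs es. cycle_with G vs es \<and> length vs = 4 \<and> set es = C)}"

text \<open>If \<open>edges G - M\<close> is a node-disjoint union of some 4-cycles, then these are all the
  4-cycles contained in it, so \<open>squares G M\<close> is the only candidate for the family.\<close>

definition square_graph :: "('v, 'e) mgraph \<Rightarrow> 'e set \<Rightarrow> bool" where
  "square_graph G M \<longleftrightarrow> wf_mgraph G \<and> cubic G \<and> two_edge_connected G \<and> perfect_matching G M \<and>
     \<Union>(squares G M) = edges G - M \<and>
     (\<forall>C\<in>squares G M. \<forall>C'\<in>squares G M. C \<noteq> C' \<longrightarrow>
        \<Union>(ends G ` C) \<inter> \<Union>(ends G ` C') = {})"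

definition delta_matroid :: "'a set \<Rightarrow> 'a set set \<Rightarrow> bool" where
  "delta_matroid S \<D> \<longleftrightarrow> finite S \<and> \<D> \<noteq> {} \<and> \<D> \<subseteq> Pow S \<and>
     (\<forall>D\<^sub>1\<in>\<D>. \<forall>D\<^sub>2\<in>\<D>. \<forall>j\<in>sym_diff D\<^sub>1 D\<^sub>2.
        \<exists>k\<in>sym_diff D\<^sub>1 D\<^sub>2. sym_diff D\<^sub>1 {j, k} \<in> \<D>)"

definition ham_cycles_containing :: "('v, 'e) mgraph \<Rightarrow> 'e set \<Rightarrow> 'e set set" where
  "ham_cycles_containing G M = {H. hamiltonian_cycle G H \<and> M \<subseteq> H}"

end

theory Submission
  imports Defs
begin

text \<open>The Hamiltonian cycles containing \<open>M\<close> are the connected 2-factors containing \<open>M\<close>. Such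
  2-factors pick one of the two pairs of opposite edges in each square, so they are closed under
  the symmetric difference with a square, and that operation merges two cycles whenever
  the square meets both. Hence a 2-factor with fewest components is connected. For the exchange
  property, switch \<open>H\<^sub>1\<close> at the square of \<open>j\<close>. This yields at most two components, and
  if there are two, the connected \<open>H\<^sub>2\<close> provides another square on which \<open>H\<^sub>1\<close> and
  \<open>H\<^sub>2\<close> differ and which meets both.\<close>

section \<open>Reachability inside an edge set, and a parity count\<close>

definition adj :: "('v, 'e) mgraph \<Rightarrow> 'e set \<Rightarrow> ('v \<times> 'v) set" where
  "adj G F = {(x, y). \<exists>e\<in>F. ends G e = {x, y}}"

definition reach :: "('v, 'e) mgraph \<Rightarrow> 'e set \<Rightarrow> ('v \<times> 'v) set" where
  "reach G F = (adj G F)\<^sup>*"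

definition two_factor :: "('v, 'e) mgraph \<Rightarrow> 'e set \<Rightarrow> bool" where
  "two_factor G F \<longleftrightarrow> F \<subseteq> edges G \<and> (\<forall>v\<in>verts G. card {e \<in> F. v \<in> ends G e} = 2)"

definition spanning_connected :: "('v, 'e) mgraph \<Rightarrow> 'e set \<Rightarrow> bool" where
  "spanning_connected G F \<longleftrightarrow> (\<forall>u\<in>verts G. \<forall>v\<in>verts G. (u, v) \<in> reach G F)"

lemma reach_refl [simp]: "(x, x) \<in> reach G F"
  by (simp add: reach_def)

lemma reach_sym: "(x, y) \<in> reach G F \<Longrightarrow> (y, x) \<in> reach G F"
proof -
  have "sym (adj G F)" by (auto simp: sym_def adj_def insert_commute)
  then show "(x, y) \<in> reach G F \<Longrightarrow> (y, x) \<in> reach G F"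
    unfolding reach_def by (meson sym_rtrancl symD)
qed

lemma reach_trans: "(x, y) \<in> reach G F \<Longrightarrow> (y, z) \<in> reach G F \<Longrightarrow> (x, z) \<in> reach G F"
  unfolding reach_def by (rule rtrancl_trans)

lemma reach_edge: "e \<in> F \<Longrightarrow> ends G e = {x, y} \<Longrightarrow> (x, y) \<in> reach G F"
  unfolding reach_def adj_def by blast

lemma reach_subset:
  assumes "\<And>e x y. e \<in> F \<Longrightarrow> ends G e = {x, y} \<Longrightarrow> (x, y) \<in> reach G F'"
  shows "reach G F \<subseteq> reach G F'"
proof -
  have "adj G F \<subseteq> reach G F'" using assms by (auto simp: adj_def)
  then show ?thesis unfolding reach_def by (rule rtrancl_subset_rtrancl)
qed

text \<open>The cut form of reachability; applied with \<open>X\<close> the nodes of a cycle, all of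
  \<open>verts G\<close>, or the union of the components of two corners.\<close>

lemma reach_closed:
  assumes "(x, y) \<in> reach G F" "x \<in> X"
    and "\<And>e u v. e \<in> F \<Longrightarrow> ends G e = {u, v} \<Longrightarrow> u \<in> X \<Longrightarrow> v \<in> X"
  shows "y \<in> X"
  using assms(1) unfolding reach_def
  by (induction rule: rtrancl_induct) (use assms(2,3) in \<open>auto simp: adj_def\<close>)

text \<open>Double counting of incidences: an edge of \<open>K\<close> has none or both of its end
  nodes in \<open>X\<close>, so it contributes 0 or 2.\<close>

lemma handshake_even:
  assumes "finite K" "finite X" and two: "\<And>e. e \<in> K \<Longrightarrow> card (ends G e) = 2"
    and closed: "\<And>e. e \<in> K \<Longrightarrow> ends G e \<inter> X \<noteq> {} \<Longrightarrow> ends G e \<subseteq> X"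
  shows "even (\<Sum>v\<in>X. card {e \<in> K. v \<in> ends G e})"
proof -
  have "(\<Sum>v\<in>X. card {e \<in> K. v \<in> ends G e}) = (\<Sum>v\<in>X. \<Sum>e\<in>K. if v \<in> ends G e then 1 else 0)"
    using assms(1) by (simp add: sum.If_cases Int_def)
  also have "\<dots> = (\<Sum>e\<in>K. \<Sum>v\<in>X. if v \<in> ends G e then 1 else 0)"
    by (rule sum.swap)
  also have "\<dots> = (\<Sum>e\<in>K. card (X \<inter> ends G e))"
    using assms(2) by (simp add: sum.If_cases)
  finally have eq: "(\<Sum>v\<in>X. card {e \<in> K. v \<in> ends G e}) = (\<Sum>e\<in>K. card (X \<inter> ends G e))" .
  have "even (card (X \<inter> ends G e))" if "e \<in> K" for e
  proof (cases "ends G e \<inter> X = {}")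
    case True
    then show ?thesis by (simp add: Int_commute)
  next
    case False
    then have "X \<inter> ends G e = ends G e" using closed that by blast
    then show ?thesis using two that by simp
  qed
  then show ?thesis unfolding eq by (rule dvd_sum)
qed

section \<open>Hamiltonian cycles as connected 2-factors\<close>

lemma wf_ends:
  assumes "wf_mgraph G" "e \<in> edges G" "x \<in> ends G e"
  obtains y where "ends G e = {x, y}" "x \<noteq> y" "x \<in> verts G" "y \<in> verts G"
proof -
  have c: "card (ends G e) = 2" and s: "ends G e \<subseteq> verts G"
    using assms unfolding wf_mgraph_def by blast+
  from c obtain a b where "ends G e = {a, b}" "a \<noteq> b" by (auto simp: card_2_iff)
  with assms(3) s that show ?thesis by (auto simp: insert_commute)
qed

lemma card2_other:
  assumes "card A = 2" "finite B" "card B \<le> 1"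
  obtains f where "f \<in> A" "f \<notin> B"
proof -
  have "\<not> A \<subseteq> B"
  proof
    assume "A \<subseteq> B"
    from card_mono[OF assms(2) this] show False using assms by linarith
  qed
  then show ?thesis using that by blast
qed

text \<open>The edges at \<open>vs ! i\<close> are \<open>es ! i\<close> and its cyclic predecessor.
  Length at least 2 keeps these positions apart; for length 2 the two edges are parallel, and
  \<open>distinct es\<close> separates them.\<close>

lemma cycle_degree:
  assumes "cycle_with G vs es" "v \<in> set vs"
  shows "card {e \<in> set es. v \<in> ends G e} = 2"
proof -
  define n where "n = length vs"
  have n: "2 \<le> n" "length es = n" "distinct vs" "distinct es"
    and E: "\<And>i. i < n \<Longrightarrow> ends G (es ! i) = {vs ! i, vs ! (Suc i mod n)}"
    using assms(1) by (auto simp: cycle_with_def n_def)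
  obtain i where i: "i < n" "v = vs ! i"
    using assms(2) by (auto simp: in_set_conv_nth n_def)
  \<comment> \<open>Cyclic predecessor of \<open>i\<close>; the case split avoids truncated
    subtraction at 0.\<close>
  define p where "p = (if i = 0 then n - 1 else i - 1)"
  have p: "p < n" "p \<noteq> i" "Suc p mod n = i" using i n by (auto simp: p_def)
  have inj: "j = p" if "j < n" "Suc j mod n = i" for j
  proof (cases "Suc j = n")
    case True
    then show ?thesis using that by (auto simp: p_def)
  next
    case False
    then have "Suc j mod n = Suc j" using that by simp
    then show ?thesis using that by (auto simp: p_def)
  qed
  have "{e \<in> set es. v \<in> ends G e} = {es ! i, es ! p}"
  proof (intro equalityI subsetI)
    fix e assume e: "e \<in> {e \<in> set es. v \<in> ends G e}"
    then obtain j where j: "j < n" "e = es ! j" using n by (auto simp: in_set_conv_nth)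
    have "v = vs ! j \<or> v = vs ! (Suc j mod n)" using e j E by auto
    then have "i = j \<or> Suc j mod n = i"
      using i j nth_eq_iff_index_eq[OF n(3), of i j] n(1)
        nth_eq_iff_index_eq[OF n(3), of i "Suc j mod n"] mod_less_divisor[of n "Suc j"]
      by (simp add: n_def[symmetric]) metis
    then show "e \<in> {es ! i, es ! p}" using inj j by auto
  next
    fix e assume "e \<in> {es ! i, es ! p}"
    then show "e \<in> {e \<in> set es. v \<in> ends G e}"
      using E[OF i(1)] E[OF p(1)] p i n by auto
  qed
  moreover have "es ! i \<noteq> es ! p" using i p n by (simp add: nth_eq_iff_index_eq)
  ultimately show ?thesis by simp
qed

lemma hamiltonian_imp_connected_two_factor:
  assumes "hamiltonian_cycle G H"
  shows "two_factor G H" "spanning_connected G H"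
proof -
  obtain vs es where c: "cycle_with G vs es" "set vs = verts G" "set es = H"
    using assms by (auto simp: hamiltonian_cycle_def)
  show "two_factor G H"
    using c cycle_degree[OF c(1)] by (auto simp: two_factor_def cycle_with_def)
  have E: "\<And>i. i < length vs \<Longrightarrow> ends G (es ! i) = {vs ! i, vs ! (Suc i mod length vs)}"
    and l: "length es = length vs"
    using c by (auto simp: cycle_with_def)
  have r: "(vs ! 0, vs ! i) \<in> reach G H" if "i < length vs" for i
    using that
  proof (induction i)
    case 0
    then show ?case by simp
  next
    case (Suc i)
    then have "ends G (es ! i) = {vs ! i, vs ! Suc i}" using E[of i] by simp
    moreover have "es ! i \<in> H" using c l Suc by auto
    ultimately show ?case using Suc by (meson Suc_lessD reach_edge reach_trans)
  qed
  then show "spanning_connected G H"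
    unfolding spanning_connected_def c(2)[symmetric]
    by (metis in_set_conv_nth reach_sym reach_trans)
qed

definition path_in :: "('v, 'e) mgraph \<Rightarrow> 'e set \<Rightarrow> 'v list \<Rightarrow> 'e list \<Rightarrow> bool" where
  "path_in G F vs es \<longleftrightarrow> length vs = Suc (length es) \<and> distinct vs \<and> set vs \<subseteq> verts G \<and>
     set es \<subseteq> F \<and> (\<forall>i<length es. ends G (es ! i) = {vs ! i, vs ! Suc i})"

text \<open>Equal edges at positions \<open>i\<close> and \<open>j\<close> would give equal
  unordered pairs of consecutive nodes. Since the nodes are distinct this forces
  \<open>i = j\<close>, the reversed pairing needing both \<open>i = Suc j\<close> and
  \<open>j = Suc i\<close>.\<close>

lemma path_in_distinct_edges:
  assumes "path_in G F vs es"
  shows "distinct es"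
  unfolding distinct_conv_nth
proof (intro allI impI)
  fix i j assume ij: "i < length es" "j < length es" "i \<noteq> j"
  show "es ! i \<noteq> es ! j"
  proof
    assume "es ! i = es ! j"
    then have "{vs ! i, vs ! Suc i} = {vs ! j, vs ! Suc j}"
      using assms ij by (metis path_in_def)
    then show False
      using assms ij by (auto simp: path_in_def doubleton_eq_iff nth_eq_iff_index_eq)
  qed
qed

text \<open>A longest path closes up: its last node has a second edge, which can only lead back to the
  first node because all inner nodes are already saturated.\<close>

lemma two_factor_contains_cycle:
  assumes wf: "wf_mgraph G" and tf: "two_factor G F" and ne: "verts G \<noteq> {}"
  obtains vs es where "cycle_with G vs es" "set es \<subseteq> F"
proof -
  have FE: "F \<subseteq> edges G" and deg: "\<And>v. v \<in> verts G \<Longrightarrow> card {e \<in> F. v \<in> ends G e} = 2"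
    using tf by (auto simp: two_factor_def)
  have finF: "finite F" using FE wf by (auto simp: wf_mgraph_def intro: finite_subset)
  let ?P = "\<lambda>(vs, es). path_in G F vs es"
  obtain v where "v \<in> verts G" using ne by blast
  then have "?P ([v], [])" by (simp add: path_in_def)
  moreover have "length (fst q) \<le> card (verts G)" if "?P q" for q
  proof -
    have "distinct (fst q)" "set (fst q) \<subseteq> verts G"
      using that by (auto simp: path_in_def split: prod.splits)
    then show ?thesis
      using wf card_mono[of "verts G" "set (fst q)"] by (simp add: distinct_card wf_mgraph_def)
  qed
  ultimately obtain p where p: "?P p" "\<And>q. ?P q \<Longrightarrow> length (fst q) \<le> length (fst p)"
    using ex_has_greatest_nat[of ?P "([v], [])" "\<lambda>q. length (fst q)" "Suc (card (verts G))"]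
    by (metis (no_types, lifting) le_imp_less_Suc)
  obtain vs es where pe: "p = (vs, es)" by (cases p)
  have P: "path_in G F vs es" using p pe by simp
  have mx: "\<And>vs' es'. path_in G F vs' es' \<Longrightarrow> length vs' \<le> length vs"
    using p(2) pe by fastforce
  define k where "k = length es"
  have L: "length vs = Suc k" "distinct vs" "set vs \<subseteq> verts G" "set es \<subseteq> F"
    and E: "\<And>i. i < k \<Longrightarrow> ends G (es ! i) = {vs ! i, vs ! Suc i}"
    using P by (auto simp: path_in_def k_def)
  let ?x = "vs ! k"
  have xV: "?x \<in> verts G" using L by auto
  let ?B = "{e \<in> set es. ?x \<in> ends G e}"
  \<comment> \<open>For \<open>k = 0\<close> the term \<open>es ! (k - 1)\<close> has no meaning,
    but then the left side is empty.\<close>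
  have "?B \<subseteq> {es ! (k - 1)}"
  proof
    fix e assume "e \<in> ?B"
    then obtain i where i: "i < k" "e = es ! i" "?x \<in> ends G e"
      by (auto simp: in_set_conv_nth k_def)
    then have "?x = vs ! i \<or> ?x = vs ! Suc i" using E by auto
    then have "k = Suc i" using i L by (auto simp: nth_eq_iff_index_eq)
    then show "e \<in> {es ! (k - 1)}" using i by simp
  qed
  then have "card ?B \<le> 1" using card_mono[of "{es ! (k - 1)}" ?B] by simp
  then obtain f where f: "f \<in> F" "?x \<in> ends G f" "f \<notin> set es"
    using card2_other[OF deg[OF xV], of ?B] by auto
  obtain w where w: "ends G f = {?x, w}" "?x \<noteq> w" "w \<in> verts G"
    using wf_ends[OF wf _ f(2)] f(1) FE by blast
  have "w \<in> set vs"
  proof (rule ccontr)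
    assume "w \<notin> set vs"
    then have "path_in G F (vs @ [w]) (es @ [f])"
      using L E f w by (auto simp: path_in_def nth_append k_def[symmetric] less_Suc_eq)
    then show False using mx by fastforce
  qed
  then obtain i where i: "i \<le> k" "w = vs ! i" using L by (auto simp: in_set_conv_nth less_Suc_eq_le)
  have ik: "i < k" using i w(2) by (cases "i = k") auto
  have "i = 0"
  proof (rule ccontr)
    assume i0: "i \<noteq> 0"
    have "ends G (es ! (i - 1)) = {vs ! (i - 1), vs ! i}" using E[of "i - 1"] i0 ik by simp
    then have "{es ! (i - 1), es ! i, f} \<subseteq> {e \<in> F. w \<in> ends G e}"
      using E[OF ik] i L(4) f w ik by (auto simp: k_def)
    then have "card {es ! (i - 1), es ! i, f} \<le> 2"
      using card_mono[of "{e \<in> F. w \<in> ends G e}" "{es ! (i - 1), es ! i, f}"] finF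
        deg[OF w(3)] by simp
    moreover have "es ! (i - 1) \<noteq> es ! i"
      using path_in_distinct_edges[OF P] i0 ik by (simp add: nth_eq_iff_index_eq k_def)
    moreover have "es ! (i - 1) \<noteq> f" "es ! i \<noteq> f"
      using f(3) ik by (auto simp: k_def)
    ultimately show False by simp
  qed
  \<comment> \<open>Here \<open>k\<close> is at least 1; for \<open>k = 1\<close> the cycle is the
    pair of parallel edges \<open>es ! 0\<close> and \<open>f\<close>.\<close>
  have "cycle_with G vs (es @ [f])"
    unfolding cycle_with_def
  proof (intro conjI allI impI)
    show "2 \<le> length vs" using L ik by simp
    show "distinct (es @ [f])" using path_in_distinct_edges[OF P] f by simp
    show "set (es @ [f]) \<subseteq> edges G" using L f FE by auto
    fix j assume "j < length vs"
    then have "j < k \<or> j = k" using L by auto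
    then show "ends G ((es @ [f]) ! j) = {vs ! j, vs ! (Suc j mod length vs)}"
      using E w i \<open>i = 0\<close> L(1) by (auto simp: nth_append k_def)
  qed (use L in \<open>auto simp: k_def\<close>)
  then show ?thesis using that[of vs "es @ [f]"] L f by auto
qed

text \<open>A cycle inside \<open>F\<close> already uses both \<open>F\<close>-edges at each of its
  nodes, so no edge of \<open>F\<close> leaves its node set, and connectivity makes it span
  \<open>verts G\<close>. Every edge of \<open>F\<close> then lies on it.\<close>

lemma connected_two_factor_imp_hamiltonian:
  assumes wf: "wf_mgraph G" and tf: "two_factor G F" and ne: "verts G \<noteq> {}"
    and con: "spanning_connected G F"
  shows "hamiltonian_cycle G F"
proof -
  obtain vs es where c: "cycle_with G vs es" "set es \<subseteq> F"
    using two_factor_contains_cycle[OF wf tf ne] .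
  have FE: "F \<subseteq> edges G" and deg: "\<And>v. v \<in> verts G \<Longrightarrow> card {e \<in> F. v \<in> ends G e} = 2"
    using tf by (auto simp: two_factor_def)
  have finF: "finite F" using FE wf by (auto simp: wf_mgraph_def intro: finite_subset)
  have vV: "set vs \<subseteq> verts G" and "vs \<noteq> []" using c by (auto simp: cycle_with_def)
  have sat: "e \<in> set es" if "v \<in> set vs" "e \<in> F" "v \<in> ends G e" for v e
  proof -
    have "{e \<in> set es. v \<in> ends G e} = {e \<in> F. v \<in> ends G e}"
      using card_subset_eq[of "{e \<in> F. v \<in> ends G e}" "{e \<in> set es. v \<in> ends G e}"]
        cycle_degree[OF c(1) that(1)] deg that(1) vV c(2) finF by auto
    then show ?thesis using that by blast
  qed
  have endsV: "ends G e \<subseteq> set vs" if "e \<in> set es" for e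
  proof -
    obtain i where "i < length es" "e = es ! i" using \<open>e \<in> set es\<close> by (auto simp: in_set_conv_nth)
    moreover have "Suc i mod length vs < length vs" using \<open>vs \<noteq> []\<close> by simp
    ultimately show ?thesis using c(1) by (auto simp: cycle_with_def)
  qed
  have "y \<in> set vs" if "y \<in> verts G" for y
  proof (rule reach_closed)
    show "hd vs \<in> set vs" using \<open>vs \<noteq> []\<close> by simp
    then show "(hd vs, y) \<in> reach G F" using con that vV by (auto simp: spanning_connected_def)
    show "v \<in> set vs" if "e \<in> F" "ends G e = {u, v}" "u \<in> set vs" for e u v
      using sat[of u e] endsV[of e] that by auto
  qed
  then have V: "set vs = verts G" using vV by blast
  have "F \<subseteq> set es"
  proof
    fix e assume e: "e \<in> F"
    then have "card (ends G e) = 2" "ends G e \<subseteq> verts G" using FE wf by (auto simp: wf_mgraph_def)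
    then obtain v where "v \<in> ends G e" "v \<in> verts G" by (auto simp: card_2_iff)
    then show "e \<in> set es" using sat e V by blast
  qed
  then show ?thesis using c V unfolding hamiltonian_cycle_def by blast
qed

section \<open>Switching squares\<close>

text \<open>Cyclic labelling of a square. Facts are proved at the corner \<open>w0\<close>, between
  \<open>c3\<close> and \<open>c0\<close>, and carried to the other corners by rotating the
  labels.\<close>

definition is_square ::
  "('v, 'e) mgraph \<Rightarrow> 'e set \<Rightarrow> 'v \<Rightarrow> 'v \<Rightarrow> 'v \<Rightarrow> 'v \<Rightarrow> 'e \<Rightarrow> 'e \<Rightarrow> 'e \<Rightarrow> 'e \<Rightarrow> bool" where
  "is_square G C w0 w1 w2 w3 c0 c1 c2 c3 \<longleftrightarrow> C = {c0, c1, c2, c3} \<and>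
     distinct [w0, w1, w2, w3] \<and> distinct [c0, c1, c2, c3] \<and>
     ends G c0 = {w0, w1} \<and> ends G c1 = {w1, w2} \<and> ends G c2 = {w2, w3} \<and> ends G c3 = {w3, w0}"

lemma is_square_rotate:
  "is_square G C w0 w1 w2 w3 c0 c1 c2 c3 \<Longrightarrow> is_square G C w1 w2 w3 w0 c1 c2 c3 c0"
  by (auto simp: is_square_def)

section \<open>Local structure of a square graph\<close>

locale matched_squares =
  fixes G :: "('v, 'e) mgraph" and M :: "'e set"
  assumes sq: "square_graph G M"
begin

lemma wf: "wf_mgraph G" and cubic: "cubic G" and G_two_connected: "two_edge_connected G"
  and M_matching: "perfect_matching G M" and squares_cover: "\<Union>(squares G M) = edges G - M"
  and squares_node_disjoint: "\<forall>C\<in>squares G M. \<forall>C'\<in>squares G M. C \<noteq> C' \<longrightarrow>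
        \<Union>(ends G ` C) \<inter> \<Union>(ends G ` C') = {}"
  using sq unfolding square_graph_def by simp_all

lemma deg3: "v \<in> verts G \<Longrightarrow> card {e \<in> edges G. v \<in> ends G e} = 3"
  using cubic by (simp add: cubic_def degree_def)

lemma verts_nonempty: "verts G \<noteq> {}" and G_connected: "spanning_connected G (edges G)"
  using G_two_connected by (simp_all add: two_edge_connected_def connected_mgraph_def
      spanning_connected_def reach_def adj_def)

lemma M_edges: "M \<subseteq> edges G" and M_unique: "v \<in> verts G \<Longrightarrow> \<exists>!e. e \<in> M \<and> v \<in> ends G e"
  using M_matching by (simp_all add: perfect_matching_def)

lemma finite_edges: "finite (edges G)" and finite_verts: "finite (verts G)"
  and ends_verts: "e \<in> edges G \<Longrightarrow> ends G e \<subseteq> verts G"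
  and ends_card: "e \<in> edges G \<Longrightarrow> card (ends G e) = 2"
  using wf by (auto simp: wf_mgraph_def)

lemma square_subset: "C \<in> squares G M \<Longrightarrow> C \<subseteq> edges G - M"
  using squares_cover by blast

text \<open>A common edge would give both squares its two end nodes, against
  node-disjointness.\<close>

lemma squares_edge_disjoint:
  assumes "C \<in> squares G M" "C' \<in> squares G M" "e \<in> C" "e \<in> C'"
  shows "C = C'"
proof (rule ccontr)
  assume "C \<noteq> C'"
  then have "ends G e = {}" using squares_node_disjoint assms by fastforce
  moreover have "card (ends G e) = 2" using assms squares_cover ends_card by blast
  ultimately show False by simp
qed

lemma square_obtain:
  assumes "C \<in> squares G M"
  obtains w0 w1 w2 w3 c0 c1 c2 c3 where "is_square G C w0 w1 w2 w3 c0 c1 c2 c3"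
proof -
  obtain vs es where c: "cycle_with G vs es" "length vs = 4" "set es = C"
    using assms by (auto simp: squares_def)
  obtain w0 w1 w2 w3 where vs: "vs = [w0, w1, w2, w3]"
    using c(2) by (auto simp: numeral_eq_Suc length_Suc_conv)
  have "length es = 4" using c by (simp add: cycle_with_def)
  then obtain c0 c1 c2 c3 where es: "es = [c0, c1, c2, c3]"
    by (auto simp: numeral_eq_Suc length_Suc_conv)
  have E: "ends G (es ! i) = {vs ! i, vs ! (Suc i mod 4)}" if "i < 4" for i
    using c that by (auto simp: cycle_with_def)
  have "is_square G C w0 w1 w2 w3 c0 c1 c2 c3"
    using c E[of 0] E[of 1] E[of 2] E[of 3] vs es
    by (auto simp: is_square_def cycle_with_def)
  then show ?thesis by (rule that)
qed

text \<open>Only one of the three edges at \<open>v\<close> is in \<open>M\<close>, so another one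
  lies in a square; rotation puts \<open>v\<close> first.\<close>

lemma square_at_node:
  assumes "v \<in> verts G"
  obtains C w1 w2 w3 c0 c1 c2 c3
  where "C \<in> squares G M" "is_square G C v w1 w2 w3 c0 c1 c2 c3"
proof -
  obtain m where m: "\<And>e. e \<in> M \<and> v \<in> ends G e \<Longrightarrow> e = m" using M_unique[OF assms] by blast
  have "\<not> {e \<in> edges G. v \<in> ends G e} \<subseteq> {m}"
  proof
    assume "{e \<in> edges G. v \<in> ends G e} \<subseteq> {m}"
    from card_mono[OF _ this] show False using deg3[OF assms] by simp
  qed
  then obtain e where e: "e \<in> edges G" "v \<in> ends G e" "e \<notin> M" using m by blast
  then obtain C where C: "C \<in> squares G M" "e \<in> C" using squares_cover by blast
  obtain w0 w1 w2 w3 c0 c1 c2 c3 where r: "is_square G C w0 w1 w2 w3 c0 c1 c2 c3"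
    using square_obtain[OF C(1)] .
  note r1 = is_square_rotate[OF r]
  note r2 = is_square_rotate[OF r1]
  note r3 = is_square_rotate[OF r2]
  have "v \<in> {w0, w1, w2, w3}" using r C e by (auto simp: is_square_def)
  then show ?thesis using that[OF C(1)] r r1 r2 r3 by blast
qed

text \<open>The matching edge and the two square edges at \<open>w0\<close> are distinct, so they
  exhaust degree 3.\<close>

lemma edges_at_square_node:
  assumes C: "C \<in> squares G M" and r: "is_square G C w0 w1 w2 w3 c0 c1 c2 c3"
  obtains m where "{e \<in> edges G. w0 \<in> ends G e} = {m, c0, c3}" "m \<in> M" "c0 \<notin> M" "c3 \<notin> M"
    "c0 \<noteq> c3" "w0 \<in> verts G"
proof -
  have c: "c0 \<in> edges G - M" "c3 \<in> edges G - M" using C r squares_cover by (auto simp: is_square_def)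
  have w: "w0 \<in> ends G c0" "w0 \<in> ends G c3" "c0 \<noteq> c3" using r by (auto simp: is_square_def)
  have V: "w0 \<in> verts G" using c w ends_verts by blast
  obtain m where m: "m \<in> M" "w0 \<in> ends G m" using M_unique[OF V] by blast
  have "m \<noteq> c0" "m \<noteq> c3" using m c by auto
  then have "card {m, c0, c3} = 3" using w(3) by simp
  then have "{m, c0, c3} = {e \<in> edges G. w0 \<in> ends G e}"
    using m c w M_edges deg3[OF V] finite_edges by (intro card_subset_eq) auto
  then show ?thesis using that m c w V by auto
qed

section \<open>2-factors containing the matching\<close>

definition factor :: "'e set \<Rightarrow> bool" where
  "factor F \<longleftrightarrow> two_factor G F \<and> M \<subseteq> F"

text \<open>Of the three edges at \<open>w0\<close> the matching edge is in \<open>F\<close>, so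
  degree 2 leaves exactly one of \<open>c0\<close> and \<open>c3\<close>.\<close>

lemma factor_alternates:
  assumes F: "factor F" and C: "C \<in> squares G M" and r: "is_square G C w0 w1 w2 w3 c0 c1 c2 c3"
  shows "c3 \<in> F \<longleftrightarrow> c0 \<notin> F"
proof -
  obtain m where m: "{e \<in> edges G. w0 \<in> ends G e} = {m, c0, c3}" "m \<in> M" "c0 \<notin> M" "c3 \<notin> M"
    "c0 \<noteq> c3" "w0 \<in> verts G" using edges_at_square_node[OF C r] .
  have "{e \<in> F. w0 \<in> ends G e} = F \<inter> {m, c0, c3}"
    unfolding m(1)[symmetric] using F by (auto simp: factor_def two_factor_def)
  moreover have "card {e \<in> F. w0 \<in> ends G e} = 2"
    using F m by (auto simp: factor_def two_factor_def)
  moreover have "m \<in> F" "m \<noteq> c0" "m \<noteq> c3" using m F by (auto simp: factor_def)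
  ultimately show ?thesis using m(5)
    by (cases "c0 \<in> F"; cases "c3 \<in> F") (auto simp: Int_insert_right)
qed

text \<open>Converse of \<open>factor_alternates\<close>: every node is a corner of some square, so
  alternation there gives degree 2.\<close>

lemma factorI:
  assumes FE: "F \<subseteq> edges G" and MF: "M \<subseteq> F"
    and alt: "\<And>C w0 w1 w2 w3 c0 c1 c2 c3. C \<in> squares G M \<Longrightarrow>
      is_square G C w0 w1 w2 w3 c0 c1 c2 c3 \<Longrightarrow> c3 \<in> F \<longleftrightarrow> c0 \<notin> F"
  shows "factor F"
proof -
  have "card {e \<in> F. v \<in> ends G e} = 2" if v: "v \<in> verts G" for v
  proof -
    obtain C w1 w2 w3 c0 c1 c2 c3 where
      C: "C \<in> squares G M" and r: "is_square G C v w1 w2 w3 c0 c1 c2 c3"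
      using square_at_node[OF v] .
    obtain m where m: "{e \<in> edges G. v \<in> ends G e} = {m, c0, c3}" "m \<in> M" "c0 \<notin> M" "c3 \<notin> M"
      "c0 \<noteq> c3" using edges_at_square_node[OF C r] .
    have "{e \<in> F. v \<in> ends G e} = F \<inter> {m, c0, c3}"
      unfolding m(1)[symmetric] using FE by auto
    moreover have "m \<in> F" "m \<noteq> c0" "m \<noteq> c3" using m MF by auto
    ultimately show ?thesis using alt[OF C r] m(5)
      by (cases "c0 \<in> F") (auto simp: Int_insert_right)
  qed
  then show ?thesis using FE MF by (simp add: factor_def two_factor_def)
qed

text \<open>Take one pair of opposite edges from each square. The choice must alternate in every
  labelling of the square, not just in the one it came from.\<close>

lemma factor_exists: "\<exists>F. factor F"
proof -
  have "\<forall>C\<in>squares G M. \<exists>P. P \<subseteq> C \<and> (\<forall>w0 w1 w2 w3 c0 c1 c2 c3.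
      is_square G C w0 w1 w2 w3 c0 c1 c2 c3 \<longrightarrow> (c3 \<in> P \<longleftrightarrow> c0 \<notin> P))"
  proof
    fix C assume "C \<in> squares G M"
    then obtain a0 a1 a2 a3 b0 b1 b2 b3 where r: "is_square G C a0 a1 a2 a3 b0 b1 b2 b3"
      using square_obtain by blast
    have "c3 \<in> {b0, b2} \<longleftrightarrow> c0 \<notin> {b0, b2}"
      if s: "is_square G C w0 w1 w2 w3 c0 c1 c2 c3" for w0 w1 w2 w3 c0 c1 c2 c3
    proof -
      \<comment> \<open>In any labelling \<open>c0\<close> and \<open>c3\<close> are distinct edges
        with a common node. As \<open>b0\<close> and \<open>b2\<close> share no node, nor do
        \<open>b1\<close> and \<open>b3\<close>, exactly one of \<open>c0\<close> and
        \<open>c3\<close> lies in \<open>{b0, b2}\<close>.\<close>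
      have "c0 \<in> {b0, b1, b2, b3}" "c3 \<in> {b0, b1, b2, b3}" "c0 \<noteq> c3"
        "ends G c0 \<inter> ends G c3 \<noteq> {}"
        using r s by (auto simp: is_square_def)
      then show ?thesis using r by (auto simp: is_square_def)
    qed
    then show "\<exists>P. P \<subseteq> C \<and> (\<forall>w0 w1 w2 w3 c0 c1 c2 c3.
      is_square G C w0 w1 w2 w3 c0 c1 c2 c3 \<longrightarrow> (c3 \<in> P \<longleftrightarrow> c0 \<notin> P))"
      using r by (intro exI[of _ "{b0, b2}"] conjI allI impI) (simp add: is_square_def, blast)
  qed
  then obtain P where P: "\<And>C. C \<in> squares G M \<Longrightarrow> P C \<subseteq> C"
    "\<And>C w0 w1 w2 w3 c0 c1 c2 c3. C \<in> squares G M \<Longrightarrow>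
      is_square G C w0 w1 w2 w3 c0 c1 c2 c3 \<Longrightarrow> c3 \<in> P C \<longleftrightarrow> c0 \<notin> P C"
    by metis
  have "factor (M \<union> (\<Union>C\<in>squares G M. P C))"
  proof (rule factorI)
    show "M \<union> (\<Union>C\<in>squares G M. P C) \<subseteq> edges G" using M_edges P(1) squares_cover by blast
    fix C w0 w1 w2 w3 c0 c1 c2 c3
    assume C: "C \<in> squares G M" and r: "is_square G C w0 w1 w2 w3 c0 c1 c2 c3"
    \<comment> \<open>Squares are disjoint from \<open>M\<close> and from each other, so on
      \<open>C\<close> the union is just \<open>P C\<close>.\<close>
    have "e \<in> M \<union> (\<Union>C\<in>squares G M. P C) \<longleftrightarrow> e \<in> P C" if "e \<in> C" for e
      using that C P(1) squares_edge_disjoint squares_cover by blast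
    then show "c3 \<in> M \<union> (\<Union>C\<in>squares G M. P C) \<longleftrightarrow> c0 \<notin> M \<union> (\<Union>C\<in>squares G M. P C)"
      using P(2)[OF C r] r by (auto simp: is_square_def)
  qed blast
  then show ?thesis by blast
qed

text \<open>Each square is either complemented as a whole or left alone, and both preserve
  alternation.\<close>

lemma factor_switch:
  assumes F: "factor F" and C: "C \<in> squares G M"
  shows "factor (sym_diff F C)"
proof (rule factorI)
  show "sym_diff F C \<subseteq> edges G"
    using F square_subset[OF C] by (auto simp: factor_def two_factor_def)
  show "M \<subseteq> sym_diff F C" using F square_subset[OF C] by (auto simp: factor_def)
  fix C' w0 w1 w2 w3 c0 c1 c2 c3
  assume C': "C' \<in> squares G M" and r: "is_square G C' w0 w1 w2 w3 c0 c1 c2 c3"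
  have c: "c0 \<in> C'" "c3 \<in> C'" using r by (auto simp: is_square_def)
  have "c0 \<in> C \<longleftrightarrow> c3 \<in> C" using c squares_edge_disjoint[OF C C'] by blast
  then show "c3 \<in> sym_diff F C \<longleftrightarrow> c0 \<notin> sym_diff F C"
    using factor_alternates[OF F C' r] by auto
qed

text \<open>Normal form: alternation makes the \<open>F\<close>-edges of \<open>C\<close> an
  opposite pair, and at most one rotation makes that pair \<open>c0\<close>,
  \<open>c2\<close>.\<close>

lemma factor_square_obtain:
  assumes F: "factor F" and C: "C \<in> squares G M"
  obtains w0 w1 w2 w3 c0 c1 c2 c3 where "is_square G C w0 w1 w2 w3 c0 c1 c2 c3"
    "c0 \<in> F" "c1 \<notin> F" "c2 \<in> F" "c3 \<notin> F"
proof -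
  obtain w0 w1 w2 w3 c0 c1 c2 c3 where r: "is_square G C w0 w1 w2 w3 c0 c1 c2 c3"
    using square_obtain[OF C] .
  note r1 = is_square_rotate[OF r]
  note r2 = is_square_rotate[OF r1]
  note r3 = is_square_rotate[OF r2]
  note a = r r1 r2 r3
  note alt = a[THEN factor_alternates[OF F C]]
  show ?thesis
  proof (cases "c0 \<in> F")
    case True
    then show ?thesis using that[OF r] alt by blast
  next
    case False
    then show ?thesis using that[OF r1] alt by blast
  qed
qed

text \<open>By alternation one edge decides the trace of a factor on \<open>C\<close>, so two
  factors are equal or complementary on a square.\<close>

lemma factor_square_agree:
  assumes F: "factor F" "factor F'" and C: "C \<in> squares G M" and e: "e \<in> C" "e' \<in> C"
  shows "(e \<in> F \<longleftrightarrow> e \<in> F') \<longleftrightarrow> (e' \<in> F \<longleftrightarrow> e' \<in> F')"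
proof -
  obtain w0 w1 w2 w3 c0 c1 c2 c3 where r: "is_square G C w0 w1 w2 w3 c0 c1 c2 c3"
    using square_obtain[OF C] .
  note r1 = is_square_rotate[OF r]
  note r2 = is_square_rotate[OF r1]
  note r3 = is_square_rotate[OF r2]
  note a = r r1 r2 r3
  have "e \<in> {c0, c1, c2, c3}" "e' \<in> {c0, c1, c2, c3}" using r e by (auto simp: is_square_def)
  then show ?thesis
    using a[THEN factor_alternates[OF F(1) C]] a[THEN factor_alternates[OF F(2) C]] by auto
qed

section \<open>How a switch changes the components\<close>

lemma reach_verts: "F \<subseteq> edges G \<Longrightarrow> u \<in> verts G \<Longrightarrow> (u, v) \<in> reach G F \<Longrightarrow> v \<in> verts G"
  by (rule reach_closed[where X = "verts G" and F = F]) (use ends_verts in auto)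

text \<open>Otherwise \<open>w0\<close> would be the only node of odd degree in its component of \<open>F - C\<close>.\<close>

lemma detour:
  assumes F: "factor F" and C: "C \<in> squares G M" and r: "is_square G C w0 w1 w2 w3 c0 c1 c2 c3"
    and c: "c0 \<in> F" "c1 \<notin> F" "c2 \<in> F" "c3 \<notin> F" and sep: "(w0, w2) \<notin> reach G F"
  shows "(w0, w1) \<in> reach G (F - C)"
proof (rule ccontr)
  assume no: "(w0, w1) \<notin> reach G (F - C)"
  define X where "X = {u. (w0, u) \<in> reach G (F - C)}"
  have E: "ends G c0 = {w0, w1}" "ends G c2 = {w2, w3}" and FC: "F - C = F - {c0, c2}"
    using r c by (auto simp: is_square_def)
  have FE: "F \<subseteq> edges G" and deg: "\<And>v. v \<in> verts G \<Longrightarrow> card {e \<in> F. v \<in> ends G e} = 2"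
    using F by (auto simp: factor_def two_factor_def)
  have finF: "finite F" using FE finite_edges finite_subset by blast
  have w0: "w0 \<in> X" by (simp add: X_def)
  have XV: "X \<subseteq> verts G"
    using reach_verts[of "F - C" w0] FE c E ends_verts unfolding X_def by blast
  have sub: "reach G (F - C) \<subseteq> reach G F" by (rule reach_subset) (auto intro: reach_edge)
  have "(w2, w3) \<in> reach G F" using reach_edge[OF c(3) E(2)] .
  then have "(w0, w3) \<notin> reach G F" using sep reach_sym reach_trans by metis
  \<comment> \<open>So \<open>w0\<close> is the only corner in \<open>X\<close>, and removing
    \<open>C\<close> costs the nodes of \<open>X\<close> only the edge \<open>c0\<close> at
    \<open>w0\<close>: degree 1 there, degree 2 elsewhere.\<close>
  then have w: "w1 \<notin> X" "w2 \<notin> X" "w3 \<notin> X"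
    using no sep sub by (auto simp: X_def)
  have "even (\<Sum>v\<in>X. card {e \<in> F - C. v \<in> ends G e})"
  proof (rule handshake_even)
    show "finite (F - C)" "finite X" using finF XV finite_verts finite_subset by auto
    show "\<And>e. e \<in> F - C \<Longrightarrow> card (ends G e) = 2" using FE ends_card by auto
    fix e assume e: "e \<in> F - C" "ends G e \<inter> X \<noteq> {}"
    then obtain x where x: "x \<in> ends G e" "x \<in> X" by blast
    then obtain y where "ends G e = {x, y}" using wf_ends[OF wf _ x(1)] e FE by blast
    then show "ends G e \<subseteq> X"
      using x e reach_edge[of e "F - C"] reach_trans unfolding X_def by fastforce
  qed
  moreover have "card {e \<in> F - C. v \<in> ends G e} = 2" if "v \<in> X - {w0}" for v
  proof -
    have "{e \<in> F - C. v \<in> ends G e} = {e \<in> F. v \<in> ends G e}" using that w E FC by auto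
    then show ?thesis using deg that XV by auto
  qed
  moreover have "card {e \<in> F - C. w0 \<in> ends G e} = 1"
  proof -
    have "w0 \<notin> ends G c2" using w w0 E by auto
    then have "{e \<in> F - C. w0 \<in> ends G e} = {e \<in> F. w0 \<in> ends G e} - {c0}" unfolding FC by auto
    then show ?thesis using deg[of w0] w0 XV c E finF by auto
  qed
  ultimately show False
    using sum.remove[of X w0 "\<lambda>v. card {e \<in> F - C. v \<in> ends G e}"] w0 XV finite_verts
    by (simp add: finite_subset)
qed

text \<open>Here \<open>w0\<close> and \<open>w2\<close> lie in different components of
  \<open>F\<close>, so \<open>detour\<close> joins the two ends of each removed edge inside
  \<open>F - C\<close>, and the new edge \<open>c1\<close> links the two detours. All corners then
  share a component.\<close>

lemma switch_merges:
  assumes F: "factor F" and C: "C \<in> squares G M"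
    and xy: "x \<in> \<Union>(ends G ` C)" "y \<in> \<Union>(ends G ` C)" "(x, y) \<notin> reach G F"
  shows "reach G F \<subseteq> reach G (sym_diff F C)" "(x, y) \<in> reach G (sym_diff F C)"
proof -
  obtain w0 w1 w2 w3 c0 c1 c2 c3 where r: "is_square G C w0 w1 w2 w3 c0 c1 c2 c3"
    and c: "c0 \<in> F" "c1 \<notin> F" "c2 \<in> F" "c3 \<notin> F" using factor_square_obtain[OF F C] .
  let ?F = "sym_diff F C"
  note r2 = is_square_rotate[OF is_square_rotate[OF r]]
  have E: "ends G c0 = {w0, w1}" "ends G c1 = {w1, w2}" "ends G c2 = {w2, w3}" "ends G c3 = {w3, w0}"
    and Ceq: "C = {c0, c1, c2, c3}" using r by (auto simp: is_square_def)
  have "(w0, w1) \<in> reach G F" "(w2, w3) \<in> reach G F"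
    using c E by (auto intro: reach_edge)
  moreover have "x \<in> {w0, w1, w2, w3}" "y \<in> {w0, w1, w2, w3}" using xy E Ceq by auto
  \<comment> \<open>The \<open>F\<close>-edges pair \<open>w0\<close> with \<open>w1\<close> and
    \<open>w2\<close> with \<open>w3\<close>, so joining \<open>w0\<close> to \<open>w2\<close>
    would join all corners, including \<open>x\<close> and \<open>y\<close>.\<close>
  ultimately have "(w0, x) \<in> reach G F \<and> (w0, y) \<in> reach G F" if "(w0, w2) \<in> reach G F"
    using that by (auto intro: reach_trans)
  then have sep: "(w0, w2) \<notin> reach G F" using xy(3) reach_sym reach_trans by metis
  have sub: "reach G (F - C) \<subseteq> reach G ?F" by (rule reach_subset) (auto intro: reach_edge)
  have 01: "(w0, w1) \<in> reach G ?F" using detour[OF F C r c sep] sub by blast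
  \<comment> \<open>The second detour is the first one in the labelling rotated by two.\<close>
  have "(w2, w0) \<notin> reach G F" using sep reach_sym by metis
  then have 23: "(w2, w3) \<in> reach G ?F" using detour[OF F C r2 c(3,4,1,2)] sub by blast
  have 12: "(w1, w2) \<in> reach G ?F" by (rule reach_edge[OF _ E(2)]) (use c Ceq in auto)
  have all: "(a, b) \<in> reach G ?F" if "a \<in> {w0, w1, w2, w3}" "b \<in> {w0, w1, w2, w3}" for a b
  proof -
    have "(w1, a) \<in> reach G ?F" if "a \<in> {w0, w1, w2, w3}" for a
      using that reach_sym[OF 01] 12 reach_trans[OF 12 23] by auto
    then show ?thesis using that reach_sym reach_trans by metis
  qed
  show "(x, y) \<in> reach G ?F" using all xy E Ceq by auto
  show "reach G F \<subseteq> reach G ?F"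
  proof (rule reach_subset)
    fix e u v assume e: "e \<in> F" "ends G e = {u, v}"
    show "(u, v) \<in> reach G ?F"
    proof (cases "e \<in> C")
      case True
      then have "{u, v} \<subseteq> {w0, w1, w2, w3}" using e E Ceq by auto
      then show ?thesis using all by auto
    next
      case False
      then show ?thesis using e reach_edge[of e ?F] by auto
    qed
  qed
qed

text \<open>Edges of \<open>F\<close> outside \<open>C\<close> survive, and the new edges
  \<open>c1\<close> and \<open>c3\<close> tie the corners into two pairs, so every node stays with
  \<open>w0\<close> or \<open>w1\<close>. The two may share a component.\<close>

lemma switch_splits:
  assumes F: "factor F" and con: "spanning_connected G F" and C: "C \<in> squares G M"
  obtains a b where "\<And>u. u \<in> verts G \<Longrightarrow>
    (a, u) \<in> reach G (sym_diff F C) \<or> (b, u) \<in> reach G (sym_diff F C)"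
proof -
  obtain w0 w1 w2 w3 c0 c1 c2 c3 where r: "is_square G C w0 w1 w2 w3 c0 c1 c2 c3"
    and c: "c0 \<in> F" "c1 \<notin> F" "c2 \<in> F" "c3 \<notin> F" using factor_square_obtain[OF F C] .
  let ?F = "sym_diff F C"
  have E: "ends G c0 = {w0, w1}" "ends G c1 = {w1, w2}" "ends G c2 = {w2, w3}" "ends G c3 = {w3, w0}"
    and Ceq: "C = {c0, c1, c2, c3}" using r by (auto simp: is_square_def)
  have 12: "(w1, w2) \<in> reach G ?F" by (rule reach_edge[OF _ E(2)]) (use c Ceq in auto)
  have "(w3, w0) \<in> reach G ?F" by (rule reach_edge[OF _ E(4)]) (use c Ceq in auto)
  then have 03: "(w0, w3) \<in> reach G ?F" by (rule reach_sym)
  define X where "X = {u. (w0, u) \<in> reach G ?F \<or> (w1, u) \<in> reach G ?F}"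
  have wX: "{w0, w1, w2, w3} \<subseteq> X" using 12 03 by (auto simp: X_def)
  have w0V: "w0 \<in> verts G" using edges_at_square_node[OF C r] by blast
  have "u \<in> X" if "u \<in> verts G" for u
  proof (rule reach_closed)
    show "(w0, u) \<in> reach G F" using con w0V that by (simp add: spanning_connected_def)
    show "w0 \<in> X" using wX by simp
    fix e x y assume e: "e \<in> F" "ends G e = {x, y}" "x \<in> X"
    show "y \<in> X"
    proof (cases "e \<in> C")
      case True
      then have "{x, y} \<subseteq> {w0, w1, w2, w3}" using e E Ceq by auto
      then show ?thesis using wX by auto
    next
      case False
      then have "(x, y) \<in> reach G ?F" using e reach_edge[of e ?F] by auto
      then show ?thesis using e(3) unfolding X_def mem_Collect_eq by (metis reach_trans)
    qed
  qed
  then show ?thesis using that unfolding X_def by blast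
qed

section \<open>Existence and exchange of Hamiltonian cycles containing the matching\<close>

lemma ham_cycles_iff: "H \<in> ham_cycles_containing G M \<longleftrightarrow> factor H \<and> spanning_connected G H"
  using hamiltonian_imp_connected_two_factor connected_two_factor_imp_hamiltonian[OF wf _ verts_nonempty]
  by (auto simp: ham_cycles_containing_def factor_def)

lemma connected_factor_exists: "\<exists>F. factor F \<and> spanning_connected G F"
proof -
  \<comment> \<open>Having few components is measured by having many reachable pairs. The
    restriction to nodes keeps the count finite, since \<open>reach\<close> is reflexive on the
    whole type.\<close>
  let ?r = "\<lambda>F. reach G F \<inter> verts G \<times> verts G"
  have fin: "finite (?r F)" for F using finite_verts by simp
  have "card (?r F) < Suc (card (verts G \<times> verts G))" for F
    using card_mono[of "verts G \<times> verts G" "?r F"] finite_verts by (simp add: less_Suc_eq_le)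
  then obtain F where F: "factor F" and mx: "\<And>F'. factor F' \<Longrightarrow> card (?r F') \<le> card (?r F)"
    using factor_exists ex_has_greatest_nat[of factor _ "\<lambda>F. card (?r F)"] by metis
  \<comment> \<open>This suffices by connectivity of \<open>G\<close>. An edge of \<open>G\<close>
    between two components of \<open>F\<close> is outside \<open>M\<close>, and switching its square
    would gain a pair and lose none.\<close>
  have "reach G (edges G) \<subseteq> reach G F"
  proof (rule reach_subset, rule ccontr)
    fix e x y assume e: "e \<in> edges G" "ends G e = {x, y}" and n: "(x, y) \<notin> reach G F"
    have "e \<notin> F" using n reach_edge[OF _ e(2)] by blast
    then have "e \<notin> M" using F by (auto simp: factor_def)
    then obtain C where C: "C \<in> squares G M" "e \<in> C" using e squares_cover by blast
    have xy: "x \<in> \<Union>(ends G ` C)" "y \<in> \<Union>(ends G ` C)" using C e by auto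
    note m = switch_merges[OF F C(1) xy n]
    have "(x, y) \<in> verts G \<times> verts G" using e ends_verts by auto
    then have "?r F \<subset> ?r (sym_diff F C)" using m n by blast
    then have "card (?r F) < card (?r (sym_diff F C))" by (rule psubset_card_mono[OF fin])
    then show False using mx[OF factor_switch[OF F C(1)]] by simp
  qed
  then show ?thesis using F G_connected by (auto simp: spanning_connected_def)
qed

text \<open>After switching \<open>C\<close> the factor agrees with \<open>H2\<close> on
  \<open>C\<close>. An edge of the connected \<open>H2\<close> between two components therefore lies
  in another square, and switching that one merges them.\<close>

lemma exchange:
  assumes H1: "factor H1" "spanning_connected G H1" and H2: "factor H2" "spanning_connected G H2"
    and C: "C \<in> squares G M" and dC: "\<And>e. e \<in> C \<Longrightarrow> e \<in> H1 \<longleftrightarrow> e \<notin> H2"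
    and dis: "\<not> spanning_connected G (sym_diff H1 C)"
  obtains C' where "C' \<in> squares G M" "C' \<noteq> C" "\<And>e. e \<in> C' \<Longrightarrow> e \<in> H1 \<longleftrightarrow> e \<notin> H2"
    "spanning_connected G (sym_diff (sym_diff H1 C) C')"
proof -
  let ?F = "sym_diff H1 C"
  have F: "factor ?F" using factor_switch[OF H1(1) C] .
  have "\<not> reach G H2 \<subseteq> reach G ?F" using dis H2(2) by (auto simp: spanning_connected_def)
  then obtain e x y where e: "e \<in> H2" "ends G e = {x, y}" and n: "(x, y) \<notin> reach G ?F"
    using reach_subset[of H2 G ?F] by blast
  have eF: "e \<notin> ?F" using reach_edge[OF _ e(2), of ?F] n by blast
  then have "e \<notin> M" using F by (auto simp: factor_def)
  moreover have "e \<in> edges G" using e H2 by (auto simp: factor_def two_factor_def)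
  ultimately obtain C' where C': "C' \<in> squares G M" "e \<in> C'" using squares_cover by blast
  have ne: "C' \<noteq> C" using eF dC e C' by blast
  then have "e \<notin> C" using squares_edge_disjoint C C' by blast
  then have "e \<notin> H1" using eF by blast
  \<comment> \<open>The edge \<open>e\<close> is in \<open>H2\<close> but not in \<open>H1\<close>,
    so the two are complementary on all of \<open>C'\<close>.\<close>
  then have d: "f \<in> H1 \<longleftrightarrow> f \<notin> H2" if "f \<in> C'" for f
    using factor_square_agree[OF H1(1) H2(1) C'(1,2) that] e by blast
  have xy: "x \<in> \<Union>(ends G ` C')" "y \<in> \<Union>(ends G ` C')" using C' e by auto
  note m = switch_merges[OF F C'(1) xy n]
  let ?F' = "sym_diff ?F C'"
  obtain a b where ab: "\<And>u. u \<in> verts G \<Longrightarrow> (a, u) \<in> reach G ?F \<or> (b, u) \<in> reach G ?F"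
    using switch_splits[OF H1 C] by blast
  have V: "x \<in> verts G" "y \<in> verts G" using ends_verts[OF \<open>e \<in> edges G\<close>] e by auto
  have u: "(x, u) \<in> reach G ?F'" if "u \<in> verts G" for u
  proof -
    \<comment> \<open>There are at most two components and \<open>x\<close> and \<open>y\<close> are
      in different ones, so together they reach every node.\<close>
    have "(x, u) \<in> reach G ?F \<or> (y, u) \<in> reach G ?F"
      using ab[OF that] ab[OF V(1)] ab[OF V(2)] n by (meson reach_sym reach_trans)
    then have "(x, u) \<in> reach G ?F' \<or> (y, u) \<in> reach G ?F'" using m(1) by blast
    then show ?thesis using m(2) by (metis reach_trans)
  qed
  have "spanning_connected G ?F'"
    unfolding spanning_connected_def using u reach_sym reach_trans by metis
  then show ?thesis using that C'(1) ne d by blast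
qed

end

section \<open>Traces of the Hamiltonian cycles on \<open>R\<close>\<close>

theorem theorem11:
  fixes G :: "('v, 'e) mgraph" and M R :: "'e set"
  assumes "square_graph G M"
    and "R \<subseteq> edges G - M"
    and "\<forall>C\<in>squares G M. \<exists>!e. e \<in> R \<inter> C"
  shows "ham_cycles_containing G M \<noteq> {} \<and>
    delta_matroid R {H \<inter> R | H. H \<in> ham_cycles_containing G M}"
proof
  interpret matched_squares G M by unfold_locales (fact assms(1))
  show ne: "ham_cycles_containing G M \<noteq> {}"
    using connected_factor_exists ham_cycles_iff by blast
  show "delta_matroid R {H \<inter> R | H. H \<in> ham_cycles_containing G M}"
    unfolding delta_matroid_def
  proof (intro conjI ballI)
    show "finite R" using assms(2) finite_edges by (meson finite_Diff finite_subset)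
    show "{H \<inter> R | H. H \<in> ham_cycles_containing G M} \<noteq> {}" using ne by blast
    show "{H \<inter> R | H. H \<in> ham_cycles_containing G M} \<subseteq> Pow R" by blast
    fix D1 D2 j
    assume "D1 \<in> {H \<inter> R | H. H \<in> ham_cycles_containing G M}"
      and "D2 \<in> {H \<inter> R | H. H \<in> ham_cycles_containing G M}"
      and j: "j \<in> sym_diff D1 D2"
    then obtain H1 H2 where D: "D1 = H1 \<inter> R" "D2 = H2 \<inter> R"
      and H1: "factor H1" "spanning_connected G H1" and H2: "factor H2" "spanning_connected G H2"
      using ham_cycles_iff by blast
    have jR: "j \<in> R" and jd: "j \<in> H1 \<longleftrightarrow> j \<notin> H2" using j D by auto
    then obtain C where C: "C \<in> squares G M" "j \<in> C" using assms(2) squares_cover by blast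
    \<comment> \<open>Since \<open>R\<close> meets \<open>C\<close> only in \<open>j\<close>,
      switching \<open>C\<close> changes the trace on \<open>R\<close> exactly at
      \<open>j\<close>.\<close>
    have CR: "C \<inter> R = {j}" using assms(3) C jR by blast
    have dC: "e \<in> H1 \<longleftrightarrow> e \<notin> H2" if "e \<in> C" for e
      using factor_square_agree[OF H1(1) H2(1) C that] jd by blast
    show "\<exists>k\<in>sym_diff D1 D2. sym_diff D1 {j, k} \<in> {H \<inter> R | H. H \<in> ham_cycles_containing G M}"
    proof (cases "spanning_connected G (sym_diff H1 C)")
      case True
      then have "sym_diff H1 C \<in> ham_cycles_containing G M"
        using factor_switch[OF H1(1) C(1)] ham_cycles_iff by blast
      \<comment> \<open>One switch suffices here, so the exchange partner is \<open>j\<close>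
        itself.\<close>
      moreover have "sym_diff D1 {j, j} = sym_diff H1 C \<inter> R" using D CR by blast
      ultimately show ?thesis using j by blast
    next
      case False
      then obtain C' where C': "C' \<in> squares G M" "C' \<noteq> C"
        "\<And>e. e \<in> C' \<Longrightarrow> e \<in> H1 \<longleftrightarrow> e \<notin> H2"
        "spanning_connected G (sym_diff (sym_diff H1 C) C')"
        using exchange[OF H1 H2 C(1) dC] by blast
      obtain k where k: "k \<in> R \<inter> C'" using assms(3) C'(1) by blast
      then have kR: "C' \<inter> R = {k}" using assms(3) C'(1) by blast
      \<comment> \<open>Distinct squares share no edge, so the two switches alter the trace at two
        different elements.\<close>
      have "k \<noteq> j" using squares_edge_disjoint[OF C(1) C'(1)] C C'(2) k by blast
      have "sym_diff (sym_diff H1 C) C' \<in> ham_cycles_containing G M"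
        using factor_switch[OF factor_switch[OF H1(1) C(1)] C'(1)] C'(4) ham_cycles_iff by blast
      moreover have "sym_diff D1 {j, k} = sym_diff (sym_diff H1 C) C' \<inter> R"
      proof (rule set_eqI)
        fix x
        have "x \<in> R \<Longrightarrow> x \<in> C \<longleftrightarrow> x = j" "x \<in> R \<Longrightarrow> x \<in> C' \<longleftrightarrow> x = k" using CR kR by blast+
        then show "x \<in> sym_diff D1 {j, k} \<longleftrightarrow> x \<in> sym_diff (sym_diff H1 C) C' \<inter> R"
          using jR k \<open>k \<noteq> j\<close> by (cases "x \<in> R") (auto simp: D)
      qed
      moreover have "k \<in> sym_diff D1 D2" using C'(3)[of k] k D by blast
      ultimately show ?thesis by blast
    qed
  qed
qed

end
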